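(* Let $\mathcal{H}$ be a complex separable Hilbert space, $W$ a bounded positive semi-definite operator on $\mathcal{H}$, $\mathcal{S}$ a (not necessarily closed) subspace of $\mathcal{H}$, and $b\in\operatorname{dom}P_{W,\mathcal{S}}$. Then $$\min_{y\in\mathcal{S}}\|y-b\|_W=\|W^{1/2}(I-P_{W,\mathcal{S}})b\|,$$ and the minimum is attained at $y\in\mathcal{S}$ if and only if $y\in P_{W,\mathcal{S}}b$. If $W$ is $\mathcal{S}$-complementable, then $$\min_{y\in\mathcal{S}}\|y-b\|_W=\|(\mathcal{S}^\perp(W))^{1/2}b\|,$$ where $\mathcal{S}^\perp(W)$ is the Schur complement of $W$ to $\mathcal{S}^\perp$.
   Context: A linear relation in $\mathcal{H}$ is a linear subspace $T$ of $\mathcal{H}\times\mathcal{H}$; operators are identified with their graphs. $\operatorname{dom}T$ is its domain, $Tx=\{y:(x,y)\in T\}$, $RT=\{(x,y): (x,z)\in T,\ (z,y)\in R\text{ for some }z\}$, $I-T=\{(x,x-y):(x,y)\in T\}$. $\|x\|_W:=\|W^{1/2}x\|$. $P_{W,\mathcal{S}}:=\{(s+n,s):s\in\mathcal{S},\ n\in(W\mathcal{S})^\perp\}$, where $(W\mathcal{S})^\perp=\{x:\langle Wx,s\rangle=0\ \forall s\in\mathcal{S}\}$; so $\operatorname{dom}P_{W,\mathcal{S}}=\mathcal{S}+(W\mathcal{S})^\perp$. For $W$ positive semi-definite, $\{y:(0,y)\in P_{W,\mathcal{S}}\}=\mathcal{S}\cap\ker W$, so $W^{1/2}(I-P_{W,\mathcal{S}})$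 is a (single-valued) operator with domain $\operatorname{dom}P_{W,\mathcal{S}}$, and $W^{1/2}(I-P_{W,\mathcal{S}})b$ denotes its value at $b$. $W$ is $\mathcal{S}$-complementable if $\operatorname{dom}P_{W,\mathcal{S}}=\mathcal{H}$. For a closed subspace $\mathcal{T}$, the Schur complement $\mathcal{T}(W)$ of $W$ to $\mathcal{T}$ is the maximum element (which exists) of $\{X\in L(\mathcal{H}):0\le X\le W,\ \operatorname{ran}X\subseteq\mathcal{T}\}$, with $L(\mathcal{H})$ the bounded operators on $\mathcal{H}$ and $\le$ the usual order on bounded selfadjoint operators. *)

theory Defs
  imports "HOL-Analysis.Analysis"
begin

class complex_vector = real_vector +
  fixes scaleC :: "complex \<Rightarrow> 'a \<Rightarrow> 'a"  (infixr \<open>*\<^sub>C\<close> 75)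
  assumes scaleC_add_right: "a *\<^sub>C (x + y) = a *\<^sub>C x + a *\<^sub>C y"
    and scaleC_add_left: "(a + b) *\<^sub>C x = a *\<^sub>C x + b *\<^sub>C x"
    and scaleC_scaleC: "a *\<^sub>C b *\<^sub>C x = (a * b) *\<^sub>C x"
    and scaleC_one: "1 *\<^sub>C x = x"
    and scaleR_scaleC: "r *\<^sub>R x = complex_of_real r *\<^sub>C x"

global_interpretation complex_vector: vector_space "scaleC :: complex \<Rightarrow> 'a \<Rightarrow> 'a::complex_vector"
  by standard (simp_all add: scaleC_add_right scaleC_add_left scaleC_scaleC scaleC_one)

text \<open>The inner product is linear in its first argument. Conjugate symmetry makes
  \<open>cinner x x\<close> real, so positivity only has to be imposed on the real part.\<close>

class complex_inner = complex_vector + real_normed_vector +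
  fixes cinner :: "'a \<Rightarrow> 'a \<Rightarrow> complex"
  assumes cinner_commute: "cinner x y = cnj (cinner y x)"
    and cinner_add_left: "cinner (x + y) z = cinner x z + cinner y z"
    and cinner_scaleC_left: "cinner (a *\<^sub>C x) y = a * cinner x y"
    and cinner_ge_zero: "0 \<le> Re (cinner x x)"
    and cinner_eq_zero_iff: "cinner x x = 0 \<longleftrightarrow> x = 0"
    and norm_eq_sqrt_cinner: "norm x = sqrt (Re (cinner x x))"

class chilbert_space = complex_inner + complete_space

definition orth_compl :: "'a::complex_inner set \<Rightarrow> 'a set" where
  "orth_compl S = {x. \<forall>s\<in>S. cinner x s = 0}"

definition bounded_clinear :: "('a::complex_inner \<Rightarrow> 'a) \<Rightarrow> bool" where
  "bounded_clinear A \<longleftrightarrow>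
     Vector_Spaces.linear scaleC scaleC A \<and> (\<exists>K. \<forall>x. norm (A x) \<le> norm x * K)"

definition selfadjoint :: "('a::complex_inner \<Rightarrow> 'a) \<Rightarrow> bool" where
  "selfadjoint A \<longleftrightarrow> bounded_clinear A \<and> (\<forall>x y. cinner (A x) y = cinner x (A y))"

definition op_le :: "('a::complex_inner \<Rightarrow> 'a) \<Rightarrow> ('a \<Rightarrow> 'a) \<Rightarrow> bool" where
  "op_le A B \<longleftrightarrow> selfadjoint A \<and> selfadjoint B \<and>
     (\<forall>x. Re (cinner (A x) x) \<le> Re (cinner (B x) x))"

definition psd :: "('a::complex_inner \<Rightarrow> 'a) \<Rightarrow> bool" where
  "psd A \<longleftrightarrow> op_le (\<lambda>x. 0) A"

definition sqrt_op :: "('a::chilbert_space \<Rightarrow> 'a) \<Rightarrow> 'a \<Rightarrow> 'a" where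
  "sqrt_op W = (THE R. psd R \<and> R \<circ> R = W)"

definition norm_op :: "('a::chilbert_space \<Rightarrow> 'a) \<Rightarrow> 'a \<Rightarrow> real" where
  "norm_op W x = norm (sqrt_op W x)"

text \<open>The set \<open>{X \<in> L(H). 0 \<le> X \<le> W, ran X \<subseteq> T}\<close>, whose maximum is the Schur complement
  of \<open>W\<close> to \<open>T\<close>; boundedness of \<open>X\<close> is part of \<^const>\<open>op_le\<close>.\<close>

definition schur_set :: "'a::chilbert_space set \<Rightarrow> ('a \<Rightarrow> 'a) \<Rightarrow> ('a \<Rightarrow> 'a) set" where
  "schur_set T W = {X. op_le (\<lambda>x. 0) X \<and> op_le X W \<and> range X \<subseteq> T}"

definition schur :: "'a::chilbert_space set \<Rightarrow> ('a \<Rightarrow> 'a) \<Rightarrow> 'a \<Rightarrow> 'a" where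
  "schur T W = (THE X. X \<in> schur_set T W \<and> (\<forall>Y\<in>schur_set T W. op_le Y X))"

text \<open>A relation \<open>T\<close> is a set of pairs, with domain \<open>Domain T\<close> and \<open>Tx = T `` {x}\<close>. The product
  \<open>RT\<close> (first \<open>T\<close>, then \<open>R\<close>) is \<open>T O R\<close>, as \<open>O\<close> composes from left to right.\<close>

definition graph_of :: "('a \<Rightarrow> 'a) \<Rightarrow> 'a rel" where
  "graph_of A = {(x, A x) |x. True}"

definition id_minus :: "'a::ab_group_add rel \<Rightarrow> 'a rel" where
  "id_minus T = {(x, x - y) |x y. (x, y) \<in> T}"

text \<open>The value at \<open>x\<close> of a single-valued relation with \<open>x\<close> in its domain; arbitrary otherwise.\<close>

definition rel_value :: "'a rel \<Rightarrow> 'a \<Rightarrow> 'a" where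
  "rel_value T x = (THE y. (x, y) \<in> T)"

text \<open>\<open>P\<^bsub>W,S\<^esub>\<close>, with \<open>n\<close> ranging over \<open>(WS)\<^sup>\<bottom> = {n. \<forall>s\<in>S. \<langle>Wn, s\<rangle> = 0}\<close>.\<close>

definition proj_rel :: "('a::complex_inner \<Rightarrow> 'a) \<Rightarrow> 'a set \<Rightarrow> 'a rel" where
  "proj_rel W S = {(s + n, s) |s n. s \<in> S \<and> (\<forall>t\<in>S. cinner (W n) t = 0)}"

definition complementable :: "('a::complex_inner \<Rightarrow> 'a) \<Rightarrow> 'a set \<Rightarrow> bool" where
  "complementable W S \<longleftrightarrow> Domain (proj_rel W S) = UNIV"

definition is_minimum :: "real \<Rightarrow> real set \<Rightarrow> bool" where
  "is_minimum m A \<longleftrightarrow> m \<in> A \<and> (\<forall>a\<in>A. m \<le> a)"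

end

theory Submission
  imports Defs
begin

text \<open>If \<open>b = s + n\<close> with \<open>s \<in> S\<close> and \<open>W n \<bottom> S\<close>, then
  \<open>\<parallel>y - b\<parallel>\<^sub>W\<^sup>2 = \<parallel>y - s\<parallel>\<^sub>W\<^sup>2 + \<parallel>n\<parallel>\<^sub>W\<^sup>2\<close> for \<open>y \<in> S\<close>, and
  \<open>\<parallel>y - s\<parallel>\<^sub>W = 0\<close> means \<open>W y = W s\<close>. In the complementable case \<open>X b = W n\<close> defines a
  bounded positive operator below \<open>W\<close> with range in \<open>S\<^sup>\<bottom>\<close>. Any other such \<open>Y\<close>
  vanishes on \<open>S\<close>, so \<open>\<langle>Y b, b\<rangle> = \<langle>Y n, n\<rangle> \<le> \<langle>W n, n\<rangle> = \<langle>X b, b\<rangle>\<close>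
  and \<open>X\<close> is the Schur complement.

  For a contraction \<open>A = I - W\<close>, the square root of \<open>W\<close> is \<open>I - Y\<close>, where \<open>Y\<close> is the limit
  of \<open>Y \<mapsto> (A + Y\<^sup>2) / 2\<close> started at \<open>0\<close>; it commutes with everything that commutes with
  \<open>W\<close>, which gives uniqueness.\<close>

section \<open>The real inner product underlying a complex one\<close>

lemma norm_power2_eq_cinner: "(norm x)\<^sup>2 = Re (cinner x x)"
  for x :: "'a::complex_inner"
  by (simp add: norm_eq_sqrt_cinner cinner_ge_zero)

lemma cinner_zero_left [simp]: "cinner 0 x = 0"
  using cinner_scaleC_left [of 0 x x] by (simp add: complex_vector.scale_zero_left)

lemma cinner_scaleR_left: "cinner (r *\<^sub>R x) y = r * cinner x y"
  by (simp add: scaleR_scaleC cinner_scaleC_left)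

lemma cinner_minus_left: "cinner (- x) y = - cinner x y"
  using cinner_scaleR_left [of "-1" x y] by simp

lemma cinner_diff_left: "cinner (x - y) z = cinner x z - cinner y z"
  using cinner_add_left [of x "- y" z] by (simp add: cinner_minus_left)

lemma cinner_zero_right [simp]: "cinner x 0 = 0"
  by (subst cinner_commute) simp

lemma cinner_scaleR_right: "cinner x (r *\<^sub>R y) = r * cinner x y"
  by (subst cinner_commute) (simp add: cinner_scaleR_left cinner_commute [of x y])

lemma cinner_add_right: "cinner x (y + z) = cinner x y + cinner x z"
  by (simp add: cinner_commute [of x] cinner_add_left)

lemma cinner_diff_right: "cinner x (y - z) = cinner x y - cinner x z"
  by (simp add: cinner_commute [of x] cinner_diff_left)

lemma cinner_minus_right: "cinner x (- y) = - cinner x y"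
  using cinner_scaleR_right [of x "-1" y] by simp

lemma Re_cinner_commute: "Re (cinner x y) = Re (cinner y x)"
  by (subst cinner_commute) simp

lemmas cinner_simps = cinner_add_left cinner_diff_left cinner_scaleR_left
  cinner_add_right cinner_diff_right cinner_scaleR_right

lemma norm_scaleC: "norm (c *\<^sub>C x) = cmod c * norm x"
  for x :: "'a::complex_inner"
proof -
  have "cinner (c *\<^sub>C x) (c *\<^sub>C x) = (c * cnj c) * cinner x x"
    by (simp add: cinner_scaleC_left cinner_commute [of x "c *\<^sub>C x"] cinner_commute [of x x, symmetric])
  then have "(norm (c *\<^sub>C x))\<^sup>2 = (cmod c * norm x)\<^sup>2"
    by (simp add: norm_power2_eq_cinner power_mult_distrib complex_norm_square [symmetric]
        flip: of_real_power)
  then show ?thesis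
    by (simp add: power2_eq_iff_nonneg)
qed

lemma bounded_linear_scaleC: "bounded_linear ((*\<^sub>C) c :: 'a::complex_inner \<Rightarrow> 'a)"
  by (rule bounded_linear_intro [where K = "cmod c"])
    (simp_all add: scaleC_add_right scaleR_scaleC scaleC_scaleC mult.commute norm_scaleC)

section \<open>Bounded, selfadjoint and positive operators\<close>

text \<open>Real scaling is complex scaling by \<open>scaleR_scaleC\<close>, so complex linearity
  contains real linearity. In this form the library facts on \<open>bounded_linear\<close> apply to
  every operator below.\<close>

lemma bounded_clinear_iff:
  "bounded_clinear A \<longleftrightarrow> bounded_linear A \<and> (\<forall>c x. A (c *\<^sub>C x) = c *\<^sub>C A x)"
  unfolding bounded_clinear_def bounded_linear_def bounded_linear_axioms_def
    Vector_Spaces.linear_iff linear_iff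
  using complex_vector.vector_space_axioms by (auto simp: scaleR_scaleC)

text \<open>Applying the hypothesis to \<open>\<i> x\<close> recovers the imaginary parts.\<close>

lemma selfadjointI:
  assumes "bounded_clinear A" and Re: "\<And>x y. Re (cinner (A x) y) = Re (cinner x (A y))"
  shows "selfadjoint A"
  unfolding selfadjoint_def
proof (intro conjI allI complex_eqI)
  show "Im (cinner (A x) y) = Im (cinner x (A y))" for x y
    using Re [of "\<i> *\<^sub>C x" y] assms(1) by (simp add: bounded_clinear_iff cinner_scaleC_left)
qed (use assms in auto)

text \<open>Two coefficients cover all later combinations: \<open>A - B\<close>,
  \<open>I - W / K\<close> and \<open>sqrt K (I - Y)\<close>.\<close>

lemma selfadjoint_scaleR_sub:
  assumes "selfadjoint A" "selfadjoint B"
  shows "selfadjoint (\<lambda>x. r *\<^sub>R A x - t *\<^sub>R B x)"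
proof (rule selfadjointI)
  show "bounded_clinear (\<lambda>x. r *\<^sub>R A x - t *\<^sub>R B x)"
    using assms unfolding selfadjoint_def bounded_clinear_iff
    by (intro conjI bounded_linear_intros)
      (auto simp: scaleR_scaleC scaleC_scaleC mult.commute complex_vector.scale_right_diff_distrib)
qed (use assms in \<open>simp add: selfadjoint_def cinner_simps\<close>)

lemma selfadjoint_id: "selfadjoint (\<lambda>x. x)"
  by (simp add: selfadjoint_def bounded_clinear_iff bounded_linear_ident)

lemma selfadjoint_zero: "selfadjoint (\<lambda>x. 0)"
  by (simp add: selfadjoint_def bounded_clinear_iff complex_vector.scale_zero_right)

lemma psd_iff: "psd A \<longleftrightarrow> selfadjoint A \<and> (\<forall>x. 0 \<le> Re (cinner (A x) x))"
  by (auto simp: psd_def op_le_def selfadjoint_zero)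

lemma psd_id: "psd (\<lambda>x. x)"
  by (simp add: psd_iff selfadjoint_id cinner_ge_zero)

text \<open>The quadratic form of \<open>A\<close> is nonnegative on the real span of
  \<open>x\<close> and \<open>y\<close>. Since it may be degenerate, the case \<open>a = 0\<close>
  is treated apart. Taking \<open>A = I\<close> gives the usual inequality.\<close>

lemma psd_Cauchy_Schwarz:
  assumes "psd A"
  shows "(Re (cinner (A x) y))\<^sup>2 \<le> Re (cinner (A x) x) * Re (cinner (A y) y)"
proof -
  define a p c where "a = Re (cinner (A x) x)" and "p = Re (cinner (A x) y)"
    and "c = Re (cinner (A y) y)"
  interpret bounded_linear A
    using assms by (simp add: psd_iff selfadjoint_def bounded_clinear_iff)
  have sym: "Re (cinner (A y) x) = p"
    using assms by (metis p_def psd_iff selfadjoint_def Re_cinner_commute)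
  have q: "0 \<le> a * r\<^sup>2 + 2 * p * r * t + c * t\<^sup>2" for r t
  proof -
    have "Re (cinner (A (r *\<^sub>R x + t *\<^sub>R y)) (r *\<^sub>R x + t *\<^sub>R y))
        = a * r\<^sup>2 + 2 * p * r * t + c * t\<^sup>2"
      by (simp add: add scaleR cinner_simps sym a_def c_def power2_eq_square algebra_simps
          flip: p_def)
    then show ?thesis
      using assms by (metis psd_iff)
  qed
  have ac: "0 \<le> a" "0 \<le> c"
    using assms by (simp_all add: psd_iff a_def c_def)
  have "p\<^sup>2 \<le> a * c"
  proof (cases "a = 0")
    case True
    \<comment> \<open>With \<open>r = -(c + 1)\<close> and \<open>t = p\<close> the right-hand side
      equals \<open>-(c + 2) p^2\<close>, which forces \<open>p = 0\<close>.\<close>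
    have "0 \<le> 2 * p * (- (c + 1) * p) + c * p\<^sup>2"
      using q [of "- (c + 1)" p] True by (simp add: algebra_simps power2_eq_square)
    then have "(c + 2) * p\<^sup>2 \<le> 0"
      by (simp add: algebra_simps power2_eq_square)
    then have "p\<^sup>2 \<le> 0"
      using ac by (simp add: mult_le_0_iff)
    then show ?thesis
      by (simp add: True)
  next
    case False
    \<comment> \<open>The choice \<open>r = -p\<close>, \<open>t = a\<close> minimizes the form in
      \<open>r\<close> for this \<open>t\<close>.\<close>
    have "0 \<le> a * (a * c - p\<^sup>2)"
      using q [of "- p" a] by (simp add: algebra_simps power2_eq_square)
    then show ?thesis
      using ac False by (simp add: zero_le_mult_iff)
  qed
  then show ?thesis
    by (simp add: a_def p_def c_def)
qed

lemma Re_cinner_le_norm: "\<bar>Re (cinner x y)\<bar> \<le> norm x * norm y"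
proof -
  have "(Re (cinner x y))\<^sup>2 \<le> (norm x * norm y)\<^sup>2"
    using psd_Cauchy_Schwarz [OF psd_id, of x y]
    by (simp add: power_mult_distrib norm_power2_eq_cinner)
  then have "\<bar>Re (cinner x y)\<bar> \<le> \<bar>norm x * norm y\<bar>"
    by (simp only: abs_le_square_iff)
  then show ?thesis
    by simp
qed

lemma bounded_linear_Re_cinner: "bounded_linear (\<lambda>x. Re (cinner x y))"
  by (rule bounded_linear_intro [where K = "norm y"])
    (simp_all add: cinner_simps Re_cinner_le_norm)

text \<open>Cauchy-Schwarz for the form of \<open>A\<close> with \<open>y = A x\<close> bounds
  \<open>norm (A x) ^ 4\<close> by the form at \<open>x\<close> times
  \<open>K * norm (A x) ^ 2\<close>; one factor \<open>norm (A x) ^ 2\<close> cancels. This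
  quantifies the fact that a zero of the form lies in the kernel.\<close>

lemma psd_norm_power2_le:
  assumes "psd A" and K: "\<And>x. norm (A x) \<le> K * norm x"
  shows "(norm (A x))\<^sup>2 \<le> K * Re (cinner (A x) x)"
proof (cases "A x = 0")
  case True
  then show ?thesis by simp
next
  case False
  let ?n = "(norm (A x))\<^sup>2"
  have pos: "0 \<le> Re (cinner (A x) x)"
    using assms by (simp add: psd_iff)
  have "Re (cinner (A (A x)) (A x)) \<le> norm (A (A x)) * norm (A x)"
    using Re_cinner_le_norm abs_le_D1 by blast
  also have "\<dots> \<le> K * ?n"
    using K [of "A x"] by (simp add: power2_eq_square mult_right_mono flip: mult.assoc)
  finally have le: "Re (cinner (A (A x)) (A x)) \<le> K * ?n" .
  have "?n\<^sup>2 \<le> Re (cinner (A x) x) * Re (cinner (A (A x)) (A x))"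
    using psd_Cauchy_Schwarz [OF assms(1), of x "A x"] by (simp add: norm_power2_eq_cinner)
  also have "\<dots> \<le> Re (cinner (A x) x) * (K * ?n)"
    using le pos by (rule mult_left_mono)
  finally show ?thesis
    using False mult_right_le_imp_le [of ?n ?n "K * Re (cinner (A x) x)"]
    by (simp add: power2_eq_square [of ?n] mult.commute mult.left_commute)
qed

lemma bounded_clinear_pos_bound:
  assumes "bounded_clinear A"
  obtains K where "0 < K" "\<And>x. norm (A x) \<le> K * norm x"
  using assms bounded_linear.pos_bounded [of A] by (auto simp: bounded_clinear_iff mult.commute)

lemma psd_eq_zero:
  assumes "psd A" "Re (cinner (A x) x) = 0"
  shows "A x = 0"
proof -
  obtain K where "\<And>x. norm (A x) \<le> K * norm x"
    using assms bounded_clinear_pos_bound by (metis psd_iff selfadjoint_def)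
  from psd_norm_power2_le [OF assms(1) this, of x] assms(2) show ?thesis
    by simp
qed

lemma op_le_antisym:
  assumes "op_le A B" "op_le B A"
  shows "A = B"
proof
  fix x
  have "psd (\<lambda>x. 1 *\<^sub>R A x - 1 *\<^sub>R B x)"
    using assms selfadjoint_scaleR_sub [of A B 1 1]
    by (simp add: psd_iff op_le_def cinner_simps)
  then show "A x = B x"
    using psd_eq_zero [of "\<lambda>x. 1 *\<^sub>R A x - 1 *\<^sub>R B x" x] assms
    by (simp add: op_le_def cinner_simps antisym)
qed

section \<open>The square root of a positive operator\<close>

primrec sqrt_iter :: "('a::real_vector \<Rightarrow> 'a) \<Rightarrow> nat \<Rightarrow> 'a \<Rightarrow> 'a" where
  "sqrt_iter A 0 = (\<lambda>x. 0)"
| "sqrt_iter A (Suc n) = (\<lambda>x. (1 / 2) *\<^sub>R (A x + sqrt_iter A n (sqrt_iter A n x)))"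

text \<open>The scalar case \<open>A = 1\<close> of the iteration, which majorizes every contraction.\<close>

primrec sqrt_majorant :: "nat \<Rightarrow> real" where
  "sqrt_majorant 0 = 0"
| "sqrt_majorant (Suc n) = (1 + (sqrt_majorant n)\<^sup>2) / 2"

lemma sqrt_majorant_bounds: "0 \<le> sqrt_majorant n \<and> sqrt_majorant n \<le> 1"
  by (induction n) (auto simp: power_le_one)

lemma incseq_sqrt_majorant: "incseq sqrt_majorant"
proof (rule incseq_SucI)
  fix n
  \<comment> \<open>The increment of the scalar iteration at \<open>y\<close> is
    \<open>(1 - y)^2 / 2\<close>.\<close>
  have "0 \<le> (1 - sqrt_majorant n)\<^sup>2"
    by simp
  then show "sqrt_majorant n \<le> sqrt_majorant (Suc n)"
    by (simp add: power2_eq_square algebra_simps)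
qed

lemma Cauchy_sqrt_majorant: "Cauchy sqrt_majorant"
  using incseq_sqrt_majorant sqrt_majorant_bounds
  by (metis incseq_convergent LIMSEQ_imp_Cauchy)

lemma selfadjoint_sqrt_iter:
  assumes "selfadjoint A"
  shows "selfadjoint (sqrt_iter A n)"
proof (induction n)
  case 0
  show ?case by (simp add: selfadjoint_zero)
next
  case (Suc n)
  let ?Y = "sqrt_iter A n"
  have "bounded_linear (\<lambda>x. (1 / 2) *\<^sub>R (A x + ?Y (?Y x)))"
    using assms Suc
    by (auto simp: selfadjoint_def bounded_clinear_iff
        intro!: bounded_linear_intros bounded_linear_compose [of ?Y])
  then have "bounded_clinear (sqrt_iter A (Suc n))"
    using assms Suc by (simp add: selfadjoint_def bounded_clinear_iff scaleR_scaleC scaleC_scaleC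
        mult.commute scaleC_add_right)
  then show ?case
    by (rule selfadjointI) (use assms Suc in \<open>simp add: selfadjoint_def cinner_simps\<close>)
qed

context
  fixes A :: "'a::complex_inner \<Rightarrow> 'a"
  assumes sa: "selfadjoint A" and contr: "\<And>x. norm (A x) \<le> norm x"
begin

lemma norm_sqrt_iter_le: "norm (sqrt_iter A n x) \<le> sqrt_majorant n * norm x"
proof (induction n arbitrary: x)
  case 0
  show ?case by simp
next
  case (Suc n)
  let ?Y = "sqrt_iter A n"
  have "norm (?Y (?Y x)) \<le> sqrt_majorant n * (sqrt_majorant n * norm x)"
    using Suc.IH [of "?Y x"] mult_left_mono [OF Suc.IH [of x], of "sqrt_majorant n"]
      sqrt_majorant_bounds [of n] by linarith
  then show ?case
    using contr [of x] norm_triangle_ineq [of "A x" "?Y (?Y x)"]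
    by (simp add: power2_eq_square distrib_right mult.assoc)
qed

text \<open>For consecutive iterates, \<open>Z Z - Y Y = (Z - Y) Z + Y (Z - Y)\<close>. Estimating
  both terms by the induction hypothesis reproduces the scalar identity
  \<open>z^2 - y^2 = (z - y) z + y (z - y)\<close>.\<close>

lemma norm_sqrt_iter_Suc_diff:
  "norm (sqrt_iter A (Suc n) x - sqrt_iter A n x)
    \<le> (sqrt_majorant (Suc n) - sqrt_majorant n) * norm x"
proof (induction n arbitrary: x)
  case 0
  show ?case using contr by simp
next
  case (Suc n)
  define Y Z y z where "Y = sqrt_iter A n" and "Z = sqrt_iter A (Suc n)"
    and "y = sqrt_majorant n" and "z = sqrt_majorant (Suc n)"
  have IH: "norm (Z x - Y x) \<le> (z - y) * norm x" for x
    unfolding Y_def Z_def y_def z_def by (rule Suc.IH)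
  have bounds: "0 \<le> y" "0 \<le> z - y"
    using sqrt_majorant_bounds [of n] incseq_SucD [OF incseq_sqrt_majorant, of n]
    by (simp_all add: y_def z_def del: sqrt_majorant.simps)
  interpret Y: bounded_linear Y
    using selfadjoint_sqrt_iter [OF sa, of n]
    by (simp add: Y_def selfadjoint_def bounded_clinear_iff)
  have "norm (Z (Z x) - Y (Y x)) = norm ((Z (Z x) - Y (Z x)) + Y (Z x - Y x))"
    by (simp add: Y.diff)
  also have "\<dots> \<le> norm (Z (Z x) - Y (Z x)) + norm (Y (Z x - Y x))"
    by (rule norm_triangle_ineq)
  also have "\<dots> \<le> (z - y) * (z * norm x) + y * ((z - y) * norm x)"
  proof (rule add_mono)
    show "norm (Z (Z x) - Y (Z x)) \<le> (z - y) * (z * norm x)"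
      using IH [of "Z x"] mult_left_mono [OF _ bounds(2), of "norm (Z x)" "z * norm x"]
        norm_sqrt_iter_le [of "Suc n" x]
      unfolding Z_def z_def by linarith
    show "norm (Y (Z x - Y x)) \<le> y * ((z - y) * norm x)"
      using norm_sqrt_iter_le [of n "Z x - Y x"] mult_left_mono [OF IH [of x] bounds(1)]
      unfolding Y_def y_def by linarith
  qed
  finally have "norm (Z (Z x) - Y (Y x)) \<le> (z\<^sup>2 - y\<^sup>2) * norm x"
    by (simp add: power2_eq_square algebra_simps)
  moreover have "sqrt_iter A (Suc (Suc n)) x - Z x = (1 / 2) *\<^sub>R (Z (Z x) - Y (Y x))"
  proof -
    have "sqrt_iter A (Suc (Suc n)) x = (1 / 2) *\<^sub>R (A x + Z (Z x))"
      by (simp only: sqrt_iter.simps(2) [of A "Suc n"] Z_def)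
    moreover have "Z x = (1 / 2) *\<^sub>R (A x + Y (Y x))"
      by (simp add: Z_def Y_def)
    ultimately show ?thesis
      by (metis add_diff_cancel_left scaleR_diff_right)
  qed
  moreover have "sqrt_majorant (Suc (Suc n)) - z = (z\<^sup>2 - y\<^sup>2) / 2"
    unfolding z_def y_def by (simp add: field_simps)
  ultimately show ?case
    unfolding Z_def [symmetric] z_def [symmetric]
    by (simp only: norm_scaleR)
qed

text \<open>Telescoping the one-step bounds; the Cauchy property of the scalar sequence then carries
  over to the iterates at each \<open>x\<close>.\<close>

lemma norm_sqrt_iter_diff:
  assumes "m \<le> n"
  shows "norm (sqrt_iter A n x - sqrt_iter A m x)
    \<le> (sqrt_majorant n - sqrt_majorant m) * norm x"
  using assms
proof (induction n rule: dec_induct)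
  case base
  show ?case by simp
next
  case (step n)
  have "norm (sqrt_iter A (Suc n) x - sqrt_iter A m x)
      \<le> norm (sqrt_iter A (Suc n) x - sqrt_iter A n x) + norm (sqrt_iter A n x - sqrt_iter A m x)"
    by (metis dist_norm dist_triangle)
  then show ?case
    using norm_sqrt_iter_Suc_diff [of n x] step.IH
    by (simp add: left_diff_distrib del: sqrt_iter.simps sqrt_majorant.simps)
qed

lemma Cauchy_sqrt_iter: "Cauchy (\<lambda>n. sqrt_iter A n x)"
proof (rule CauchyI')
  fix e :: real
  assume "0 < e"
  \<comment> \<open>The summand \<open>1\<close> keeps the denominator positive when
    \<open>x = 0\<close>.\<close>
  then have "0 < e / (norm x + 1)"
    by (simp add: add_nonneg_pos)
  with Cauchy_sqrt_majorant obtain M where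
    M: "\<And>m n. m \<ge> M \<Longrightarrow> n \<ge> M \<Longrightarrow> dist (sqrt_majorant m) (sqrt_majorant n) < e / (norm x + 1)"
    unfolding Cauchy_def by blast
  show "\<exists>M. \<forall>m\<ge>M. \<forall>n>m. dist (sqrt_iter A m x) (sqrt_iter A n x) < e"
  proof (intro exI allI impI)
    fix m n
    assume mn: "M \<le> m" "m < n"
    have "0 \<le> sqrt_majorant n - sqrt_majorant m"
      using incseqD [OF incseq_sqrt_majorant, of m n] mn by simp
    moreover have "sqrt_majorant n - sqrt_majorant m < e / (norm x + 1)"
      using M [of m n] mn by (simp add: dist_real_def)
    then have "(sqrt_majorant n - sqrt_majorant m) * (norm x + 1) < e"
      by (simp add: pos_less_divide_eq add_nonneg_pos)
    ultimately have "(sqrt_majorant n - sqrt_majorant m) * norm x < e"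
      by (simp add: algebra_simps)
    then show "dist (sqrt_iter A m x) (sqrt_iter A n x) < e"
      using norm_sqrt_iter_diff [of m n x] mn by (simp add: dist_norm norm_minus_commute)
  qed
qed

end

lemma sqrt_iter_commute:
  assumes "bounded_clinear B" "\<And>x. B (A x) = A (B x)"
  shows "B (sqrt_iter A n x) = sqrt_iter A n (B x)"
proof (induction n arbitrary: x)
  interpret bounded_linear B
    using assms by (simp add: bounded_clinear_iff)
  case 0
  show ?case by simp
next
  interpret bounded_linear B
    using assms by (simp add: bounded_clinear_iff)
  case (Suc n)
  then show ?case by (simp add: add scaleR assms)
qed

text \<open>The fixed-point equation says \<open>(I - Y)^2 = I - A\<close>. Convergence is
  pointwise; linearity, symmetry and the norm bound pass to the limit, and so does commutation with
  \<open>B\<close>, because the iterates are polynomials in \<open>A\<close>.\<close>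

lemma sqrt_iter_limit:
  fixes A :: "'a::chilbert_space \<Rightarrow> 'a"
  assumes sa: "selfadjoint A" and contr: "\<And>x. norm (A x) \<le> norm x"
  obtains Y where "selfadjoint Y" "\<And>x. norm (Y x) \<le> norm x"
    "\<And>x. 2 *\<^sub>R Y x = A x + Y (Y x)"
    "\<And>B x. bounded_clinear B \<Longrightarrow> (\<And>x. B (A x) = A (B x)) \<Longrightarrow> B (Y x) = Y (B x)"
proof -
  define Y where "Y x = lim (\<lambda>n. sqrt_iter A n x)" for x
  have lim: "(\<lambda>n. sqrt_iter A n x) \<longlonglongrightarrow> Y x" for x
    using Cauchy_sqrt_iter [OF assms] unfolding Y_def
    by (metis Cauchy_convergent convergent_LIMSEQ_iff)
  have iter: "bounded_linear (sqrt_iter A n)" "sqrt_iter A n (c *\<^sub>C x) = c *\<^sub>C sqrt_iter A n x"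
    "cinner (sqrt_iter A n x) y = cinner x (sqrt_iter A n y)" for n c x y
    using selfadjoint_sqrt_iter [OF sa, of n] by (simp_all add: selfadjoint_def bounded_clinear_iff)
  have iter_norm: "norm (sqrt_iter A n x) \<le> norm x" for n x
    using norm_sqrt_iter_le [OF assms, of n x] sqrt_majorant_bounds [of n]
      mult_right_mono [of "sqrt_majorant n" 1 "norm x"] by simp
  have norm: "norm (Y x) \<le> norm x" for x
    by (rule tendsto_upperbound [OF tendsto_norm [OF lim]]) (simp_all add: iter_norm)
  have "bounded_linear Y"
  proof (rule bounded_linear_intro [where K = 1])
    show "Y (x + y) = Y x + Y y" for x y
      using tendsto_add [OF lim [of x] lim [of y]] lim [of "x + y"]
      by (simp add: linear_add [OF bounded_linear.linear [OF iter(1)]] LIMSEQ_unique)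
    show "Y (r *\<^sub>R x) = r *\<^sub>R Y x" for r x
      using tendsto_scaleR [OF tendsto_const [of r] lim [of x]] lim [of "r *\<^sub>R x"]
      by (simp add: linear_cmul [OF bounded_linear.linear [OF iter(1)]] LIMSEQ_unique)
  qed (simp add: norm)
  moreover have "Y (c *\<^sub>C x) = c *\<^sub>C Y x" for c x
    using bounded_linear.tendsto [OF bounded_linear_scaleC lim [of x], of c] lim [of "c *\<^sub>C x"]
    by (simp add: iter(2) LIMSEQ_unique)
  ultimately have Y: "bounded_clinear Y"
    by (simp add: bounded_clinear_iff)
  have "selfadjoint Y"
  proof (rule selfadjointI [OF Y])
    fix x y
    have "(\<lambda>n. Re (cinner (sqrt_iter A n x) y)) \<longlonglongrightarrow> Re (cinner (Y x) y)"
      by (rule bounded_linear.tendsto [OF bounded_linear_Re_cinner lim])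
    moreover have "(\<lambda>n. Re (cinner (sqrt_iter A n x) y)) \<longlonglongrightarrow> Re (cinner x (Y y))"
      using bounded_linear.tendsto [OF bounded_linear_Re_cinner lim [of y], of x]
      by (simp only: iter(3) [of _ x] Re_cinner_commute [of _ x])
    ultimately show "Re (cinner (Y x) y) = Re (cinner x (Y y))"
      by (rule LIMSEQ_unique)
  qed
  moreover have "2 *\<^sub>R Y x = A x + Y (Y x)" for x
  proof -
    \<comment> \<open>Pointwise limits do not compose by themselves. Here the iterates are
      contractions, so replacing the inner iterate by \<open>Y x\<close> costs an error tending to
      \<open>0\<close>.\<close>
    have "(\<lambda>n. sqrt_iter A n (sqrt_iter A n x - Y x)) \<longlonglongrightarrow> 0"
    proof (rule Lim_null_comparison)
      show "\<forall>\<^sub>F n in sequentially.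
          norm (sqrt_iter A n (sqrt_iter A n x - Y x)) \<le> norm (sqrt_iter A n x - Y x)"
        by (simp add: iter_norm)
      show "(\<lambda>n. norm (sqrt_iter A n x - Y x)) \<longlonglongrightarrow> 0"
        using lim [of x] by (simp add: LIM_zero tendsto_norm_zero)
    qed
    from tendsto_add [OF this lim [of "Y x"]]
    have "(\<lambda>n. sqrt_iter A n (sqrt_iter A n x)) \<longlonglongrightarrow> Y (Y x)"
      by (simp add: linear_diff [OF bounded_linear.linear [OF iter(1)]])
    then have "(\<lambda>n. sqrt_iter A (Suc n) x) \<longlonglongrightarrow> (1 / 2) *\<^sub>R (A x + Y (Y x))"
      by (auto intro!: tendsto_intros)
    moreover have "(\<lambda>n. sqrt_iter A (Suc n) x) \<longlonglongrightarrow> Y x"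
      using lim [of x] by (rule LIMSEQ_Suc)
    ultimately have "Y x = (1 / 2) *\<^sub>R (A x + Y (Y x))"
      using LIMSEQ_unique by blast
    then have "2 *\<^sub>R Y x = 2 *\<^sub>R (1 / 2) *\<^sub>R (A x + Y (Y x))"
      by (rule arg_cong)
    then show ?thesis by simp
  qed
  moreover have "B (Y x) = Y (B x)" if "bounded_clinear B" "\<And>x. B (A x) = A (B x)" for B x
  proof -
    have "(\<lambda>n. B (sqrt_iter A n x)) \<longlonglongrightarrow> B (Y x)"
      using that(1) bounded_linear.tendsto [OF _ lim] by (auto simp: bounded_clinear_iff)
    then show ?thesis
      using lim [of "B x"] by (simp add: sqrt_iter_commute [of B A, OF that] LIMSEQ_unique)
  qed
  ultimately show ?thesis
    using that norm by blast
qed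

lemma psd_sqrt_exists:
  fixes W :: "'a::chilbert_space \<Rightarrow> 'a"
  assumes "psd W"
  obtains R where "psd R" "R \<circ> R = W"
    "\<And>B x. bounded_clinear B \<Longrightarrow> (\<And>x. B (W x) = W (B x)) \<Longrightarrow> B (R x) = R (B x)"
proof -
  have W: "selfadjoint W" "\<And>x. 0 \<le> Re (cinner (W x) x)"
    using assms by (simp_all add: psd_iff)
  obtain K where K: "0 < K" "\<And>x. norm (W x) \<le> K * norm x"
    using W bounded_clinear_pos_bound selfadjoint_def by metis
  \<comment> \<open>Dividing by the bound \<open>K\<close> makes \<open>I - W / K\<close> a
    contraction: in the expansion of its squared norm, \<open>psd_norm_power2_le\<close> lets half
    of the negative cross term absorb the quadratic term.\<close>
  define A where "A x = 1 *\<^sub>R x - (1 / K) *\<^sub>R W x" for x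
  have A: "selfadjoint A"
    unfolding A_def by (rule selfadjoint_scaleR_sub [OF selfadjoint_id W(1)])
  have contr: "norm (A x) \<le> norm x" for x
  proof -
    have "(norm (A x))\<^sup>2 = Re (cinner (A x) (A x))"
      by (rule norm_power2_eq_cinner)
    also have "\<dots> = Re (cinner x x) - (2 / K) * Re (cinner (W x) x) + Re (cinner (W x) (W x)) / K\<^sup>2"
      by (simp add: A_def cinner_simps Re_cinner_commute [of x "W x"] power2_eq_square diff_divide_distrib)
    also have "\<dots> = (norm x)\<^sup>2 - (2 / K) * Re (cinner (W x) x) + (norm (W x))\<^sup>2 / K\<^sup>2"
      by (simp only: norm_power2_eq_cinner)
    also have "(norm (W x))\<^sup>2 / K\<^sup>2 \<le> Re (cinner (W x) x) / K"
      using psd_norm_power2_le [OF assms K(2), of x] K(1)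
      by (simp add: power2_eq_square field_simps)
    also have "(norm x)\<^sup>2 - 2 / K * Re (cinner (W x) x) + Re (cinner (W x) x) / K \<le> (norm x)\<^sup>2"
      using W(2) [of x] K(1) by (simp add: field_simps)
    finally show ?thesis
      by (simp add: power2_le_iff_abs_le)
  qed
  obtain Y where Y: "selfadjoint Y" "\<And>x. norm (Y x) \<le> norm x"
    "\<And>x. 2 *\<^sub>R Y x = A x + Y (Y x)"
    "\<And>B x. bounded_clinear B \<Longrightarrow> (\<And>x. B (A x) = A (B x)) \<Longrightarrow> B (Y x) = Y (B x)"
    using sqrt_iter_limit [OF A contr] by metis
  interpret Y: bounded_linear Y
    using Y(1) by (simp add: selfadjoint_def bounded_clinear_iff)
  \<comment> \<open>Since \<open>(I - Y)^2 = I - A = W / K\<close>, the factor \<open>sqrt K\<close>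
    undoes the scaling.\<close>
  define R where "R x = sqrt K *\<^sub>R x - sqrt K *\<^sub>R Y x" for x
  show ?thesis
  proof
    have "selfadjoint R"
      unfolding R_def by (rule selfadjoint_scaleR_sub [OF selfadjoint_id Y(1)])
    moreover have "0 \<le> Re (cinner (R x) x)" for x
    proof -
      have "Re (cinner (Y x) x) \<le> norm (Y x) * norm x"
        using Re_cinner_le_norm abs_le_D1 by blast
      also have "\<dots> \<le> Re (cinner x x)"
        using Y(2) by (simp add: mult_right_mono power2_eq_square flip: norm_power2_eq_cinner)
      finally show ?thesis
        using K(1) by (simp add: R_def cinner_simps mult_left_mono)
    qed
    ultimately show "psd R"
      by (simp add: psd_iff)
    show "R \<circ> R = W"
    proof
      fix x
      have "(R \<circ> R) x = K *\<^sub>R (x - 2 *\<^sub>R Y x + Y (Y x))"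
        using K(1) by (simp add: R_def Y.diff Y.scaleR scaleR_2 algebra_simps)
      also have "\<dots> = W x"
        using K(1) by (simp add: Y(3) A_def algebra_simps)
      finally show "(R \<circ> R) x = W x" .
    qed
    show "B (R x) = R (B x)" if B: "bounded_clinear B" "\<And>x. B (W x) = W (B x)" for B x
    proof -
      interpret B: bounded_linear B
        using B(1) by (simp add: bounded_clinear_iff)
      have "B (A x) = A (B x)" for x
        by (simp add: A_def B.diff B.scaleR B(2))
      then show ?thesis
        by (simp add: R_def B.diff B.scaleR Y(4) [OF B(1)])
    qed
  qed
qed

text \<open>For uniqueness, a second root \<open>Q\<close> commutes with \<open>W = Q^2\<close>,
  hence with \<open>R\<close>. For \<open>y = (Q - R) x\<close> this gives
  \<open>(Q + R) y = 0\<close>; by positivity \<open>Q y = R y = 0\<close>, so the inner product of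
  \<open>y\<close> with itself, which is that of \<open>x\<close> with \<open>(Q - R) y\<close>,
  vanishes.\<close>

lemma sqrt_op_properties:
  fixes W :: "'a::chilbert_space \<Rightarrow> 'a"
  assumes "psd W"
  shows "psd (sqrt_op W) \<and> sqrt_op W \<circ> sqrt_op W = W"
proof -
  obtain R where R: "psd R" "R \<circ> R = W"
    and commute: "\<And>B x. bounded_clinear B \<Longrightarrow> (\<And>x. B (W x) = W (B x)) \<Longrightarrow> B (R x) = R (B x)"
    using psd_sqrt_exists [OF assms] by metis
  have "Q = R" if Q: "psd Q" "Q \<circ> Q = W" for Q
  proof
    fix x
    interpret Q: bounded_linear Q
      using Q(1) by (simp add: psd_iff selfadjoint_def bounded_clinear_iff)
    interpret R: bounded_linear R
      using R(1) by (simp add: psd_iff selfadjoint_def bounded_clinear_iff)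
    have QQ: "Q (Q x) = W x" and RR: "R (R x) = W x" for x
      using Q(2) R(2) by (auto simp: fun_eq_iff)
    have QR: "Q (R x) = R (Q x)" for x
      by (rule commute) (use Q in \<open>simp_all add: psd_iff selfadjoint_def flip: QQ\<close>)
    define y where "y = Q x - R x"
    have "Q y + R y = 0"
      by (simp add: y_def Q.diff R.diff QQ RR QR)
    then have "Re (cinner (Q y) y) + Re (cinner (R y) y) = 0"
      by (metis cinner_add_left cinner_zero_left plus_complex.simps(1) zero_complex.simps(1))
    moreover have "0 \<le> Re (cinner (Q y) y)" "0 \<le> Re (cinner (R y) y)"
      using Q(1) R(1) by (simp_all add: psd_iff)
    ultimately have "Q y = 0" "R y = 0"
      using psd_eq_zero [OF Q(1), of y] psd_eq_zero [OF R(1), of y] by simp_all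
    moreover have "cinner y y = cinner x (Q y) - cinner x (R y)"
      using Q(1) R(1) by (simp add: y_def psd_iff selfadjoint_def cinner_diff_left)
    ultimately have "cinner y y = 0"
      by simp
    then have "y = 0"
      by (simp only: cinner_eq_zero_iff)
    then show "Q x = R x"
      by (simp add: y_def)
  qed
  then have "\<exists>!R. psd R \<and> R \<circ> R = W"
    using R by blast
  then show ?thesis
    unfolding sqrt_op_def by (rule theI')
qed

text \<open>This reduces weighted norms to the quadratic form of \<open>W\<close>, so that later
  arguments seldom touch the root itself.\<close>

lemma norm_sqrt_op_power2:
  assumes "psd W"
  shows "(norm (sqrt_op W x))\<^sup>2 = Re (cinner (W x) x)"
proof -
  have "cinner (sqrt_op W x) (sqrt_op W x) = cinner ((sqrt_op W \<circ> sqrt_op W) x) x"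
    using sqrt_op_properties [OF assms] unfolding psd_iff selfadjoint_def o_def by metis
  then show ?thesis
    using sqrt_op_properties [OF assms] by (simp add: norm_power2_eq_cinner)
qed

section \<open>The weighted projection and the Schur complement\<close>

context
  fixes W :: "'a::chilbert_space \<Rightarrow> 'a" and S :: "'a set"
  assumes psd: "psd W" and sub: "complex_vector.subspace S"
begin

interpretation W: bounded_linear W
  using psd by (simp add: psd_iff selfadjoint_def bounded_clinear_iff)

lemma W_adjoint: "cinner (W x) y = cinner x (W y)"
  using psd by (simp add: psd_iff selfadjoint_def)

lemma proj_rel_iff: "(b, s) \<in> proj_rel W S \<longleftrightarrow> s \<in> S \<and> (\<forall>t\<in>S. cinner (W (b - s)) t = 0)"
proof
  assume "s \<in> S \<and> (\<forall>t\<in>S. cinner (W (b - s)) t = 0)"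
  moreover have "b = s + (b - s)"
    by simp
  ultimately show "(b, s) \<in> proj_rel W S"
    unfolding proj_rel_def by blast
qed (auto simp: proj_rel_def)

text \<open>In \<open>y - b = (y - s) - (b - s)\<close> the cross terms vanish, since
  \<open>y - s\<close> lies in \<open>S\<close> and \<open>W\<close> is selfadjoint. The case
  \<open>y = 0\<close> later yields the bound of the Schur complement by \<open>W\<close>.\<close>

lemma quadratic_pythagoras:
  assumes "(b, s) \<in> proj_rel W S" "y \<in> S"
  shows "Re (cinner (W (y - b)) (y - b))
    = Re (cinner (W (y - s)) (y - s)) + Re (cinner (W (b - s)) (b - s))"
proof -
  let ?n = "b - s" and ?d = "y - s"
  have "?d \<in> S"
    using assms sub by (simp add: proj_rel_iff complex_vector.subspace_diff)
  then have 1: "cinner (W ?n) ?d = 0"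
    using assms by (simp add: proj_rel_iff)
  then have 2: "cinner (W ?d) ?n = 0"
    by (metis W_adjoint cinner_commute complex_cnj_zero)
  have "y - b = ?d - ?n"
    by simp
  then have "cinner (W (y - b)) (y - b) = cinner (W (?d - ?n)) (?d - ?n)"
    by (rule arg_cong)
  also have "\<dots> = cinner (W ?d) ?d + cinner (W ?n) ?n"
    by (simp only: W.diff [of ?d ?n] cinner_diff_left [of "W ?d"] cinner_diff_right [of _ ?d ?n] 1 2)
      simp
  finally show ?thesis
    by simp
qed

section \<open>Minimal distance and minimizers in the weighted norm\<close>

lemma norm_op_pythagoras:
  assumes "(b, s) \<in> proj_rel W S" "y \<in> S"
  shows "(norm_op W (y - b))\<^sup>2 = (norm_op W (y - s))\<^sup>2 + (norm_op W (b - s))\<^sup>2"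
  using quadratic_pythagoras [OF assms] by (simp add: norm_op_def norm_sqrt_op_power2 psd)

lemma norm_op_minus: "norm_op W (x - y) = norm_op W (y - x)"
proof -
  interpret bounded_linear "sqrt_op W"
    using sqrt_op_properties [OF psd] by (simp add: psd_iff selfadjoint_def bounded_clinear_iff)
  show ?thesis
    by (simp add: norm_op_def diff norm_minus_commute)
qed

lemma norm_op_nonneg: "0 \<le> norm_op W x"
  by (simp add: norm_op_def)

lemma norm_op_eq_zero_imp: "norm_op W x = 0 \<Longrightarrow> W x = 0"
  using norm_sqrt_op_power2 [OF psd, of x] psd_eq_zero [OF psd, of x] by (simp add: norm_op_def)

lemma norm_op_ge_proj:
  assumes "(b, s) \<in> proj_rel W S" "y \<in> S"
  shows "norm_op W (b - s) \<le> norm_op W (y - b)"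
  by (rule power2_le_imp_le) (simp_all add: norm_op_pythagoras [OF assms] norm_op_nonneg)

lemma is_minimum_proj:
  assumes "(b, s) \<in> proj_rel W S"
  shows "is_minimum (norm_op W (b - s)) ((\<lambda>y. norm_op W (y - b)) ` S)"
  using assms norm_op_ge_proj [OF assms]
  by (auto simp: is_minimum_def proj_rel_iff norm_op_minus [of b s])

text \<open>\<open>W (s - s')\<close> is the difference of \<open>W (b - s')\<close> and
  \<open>W (b - s)\<close>, hence orthogonal to \<open>S\<close>, which contains
  \<open>s - s'\<close>; so the form of \<open>W\<close> vanishes there. Thus
  \<open>W (b - s)\<close> depends on \<open>b\<close> alone.\<close>

lemma proj_unique:
  assumes "(b, s) \<in> proj_rel W S" "(b, s') \<in> proj_rel W S"
  shows "W (s - s') = 0"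
proof (rule psd_eq_zero [OF psd])
  have "s - s' \<in> S"
    using assms sub by (simp add: proj_rel_iff complex_vector.subspace_diff)
  then have "cinner (W (b - s')) (s - s') = 0" "cinner (W (b - s)) (s - s') = 0"
    using assms by (simp_all add: proj_rel_iff)
  moreover have "cinner (W (s - s')) (s - s') = cinner (W (b - s')) (s - s') - cinner (W (b - s)) (s - s')"
    by (simp add: W.diff flip: cinner_diff_left)
  ultimately show "Re (cinner (W (s - s')) (s - s')) = 0"
    by simp
qed

text \<open>A minimizer \<open>y\<close> satisfies \<open>W y = W s\<close> by the Pythagorean
  identity, and for \<open>y\<close> in \<open>S\<close> the relation depends on \<open>y\<close>
  only through \<open>W (b - y)\<close>.\<close>

lemma is_arg_min_iff_proj:
  assumes "(b, s) \<in> proj_rel W S" "y \<in> S"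
  shows "is_arg_min (\<lambda>y. norm_op W (y - b)) (\<lambda>y. y \<in> S) y \<longleftrightarrow> (b, y) \<in> proj_rel W S"
proof
  assume "is_arg_min (\<lambda>y. norm_op W (y - b)) (\<lambda>y. y \<in> S) y"
  then have "norm_op W (y - b) \<le> norm_op W (b - s)"
    using assms by (auto simp: is_arg_min_linorder proj_rel_iff norm_op_minus [of b s])
  then have "(norm_op W (y - b))\<^sup>2 \<le> (norm_op W (b - s))\<^sup>2"
    by (simp add: norm_op_nonneg power_mono)
  then have "norm_op W (y - s) = 0"
    using norm_op_pythagoras [OF assms] by simp
  then have "W (y - s) = 0"
    by (rule norm_op_eq_zero_imp)
  then have "W (b - y) = W (b - s)"
    by (simp add: W.diff)
  then show "(b, y) \<in> proj_rel W S"
    using assms by (simp add: proj_rel_iff)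
next
  assume "(b, y) \<in> proj_rel W S"
  then show "is_arg_min (\<lambda>y. norm_op W (y - b)) (\<lambda>y. y \<in> S) y"
    using norm_op_ge_proj assms(2) by (simp add: is_arg_min_linorder norm_op_minus [of y b])
qed

text \<open>Reading off the value requires the composed relation to be single-valued at
  \<open>b\<close>: two choices of \<open>s\<close> differ by a vector in the kernel of
  \<open>W\<close>, which the square root also annihilates.\<close>

lemma norm_rel_value_id_minus_proj:
  assumes "(b, s) \<in> proj_rel W S"
  shows "norm (rel_value (id_minus (proj_rel W S) O graph_of (sqrt_op W)) b) = norm_op W (b - s)"
proof -
  let ?R = "id_minus (proj_rel W S) O graph_of (sqrt_op W)"
  interpret R: bounded_linear "sqrt_op W"
    using sqrt_op_properties [OF psd] by (simp add: psd_iff selfadjoint_def bounded_clinear_iff)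
  have mem: "(b, z) \<in> ?R \<longleftrightarrow> (\<exists>s'. (b, s') \<in> proj_rel W S \<and> z = sqrt_op W (b - s'))" for z
    by (auto simp: id_minus_def graph_of_def)
  have eq: "sqrt_op W (b - s') = sqrt_op W (b - s)" if "(b, s') \<in> proj_rel W S" for s'
  proof -
    have "(norm (sqrt_op W (s - s')))\<^sup>2 = 0"
      using proj_unique [OF assms that] by (simp add: norm_sqrt_op_power2 psd)
    then show ?thesis
      by (simp add: R.diff)
  qed
  have "rel_value ?R b = sqrt_op W (b - s)"
    unfolding rel_value_def mem
  proof (rule the_equality)
    show "z = sqrt_op W (b - s)" if "\<exists>s'. (b, s') \<in> proj_rel W S \<and> z = sqrt_op W (b - s')" for z
      using that eq by metis
  qed (use assms in blast)
  then show ?thesis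
    by (simp add: norm_op_def)
qed

text \<open>In the complementable case the Schur complement is \<open>W (I - P\<^bsub>W,S\<^esub>)\<close>.\<close>

lemma schur_complementable:
  assumes "complementable W S" "(b, s) \<in> proj_rel W S"
  shows "psd (schur (orth_compl S) W)" "schur (orth_compl S) W b = W (b - s)"
proof -
  \<comment> \<open>This choice may be neither linear nor bounded; \<open>X\<close> is both, because
    \<open>W (x - s)\<close> is the same for every admissible \<open>s\<close>.\<close>
  define p where "p x = (SOME s. (x, s) \<in> proj_rel W S)" for x
  have p: "(x, p x) \<in> proj_rel W S" for x
    using assms(1) unfolding p_def complementable_def by (metis DomainE UNIV_I someI_ex)
  define X where "X x = W (x - p x)" for x
  have X_eq: "X x = W (x - s)" if "(x, s) \<in> proj_rel W S" for x s
    using proj_unique [OF that p [of x]] by (simp add: X_def W.diff)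
  have X_orth: "cinner (X x) s = 0" if "s \<in> S" for x s
    using p [of x] that by (simp add: X_def proj_rel_iff)
  have pS: "p x \<in> S" for x
    using p [of x] by (simp add: proj_rel_iff)
  \<comment> \<open>Orthogonality of \<open>X x\<close> to \<open>p y\<close> makes the form of
    \<open>X\<close> the form of \<open>W\<close> on the components \<open>x - p x\<close>;
    positivity and symmetry follow from it.\<close>
  have X_inner: "cinner (X x) y = cinner (W (x - p x)) (y - p y)" for x y
    using X_orth [OF pS] by (simp add: cinner_diff_right) (simp add: X_def)
  have X_add: "X (x + y) = X x + X y" for x y
  proof -
    have "(x + y, p x + p y) \<in> proj_rel W S"
      using p [of x] p [of y] sub
      by (simp add: proj_rel_iff complex_vector.subspace_add W.diff W.add cinner_add_left cinner_diff_left)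
    from X_eq [OF this] show ?thesis
      by (simp add: X_def W.diff W.add)
  qed
  have W_scaleC: "W (c *\<^sub>C x) = c *\<^sub>C W x" for c x
    using psd by (simp add: psd_iff selfadjoint_def bounded_clinear_iff)
  have X_scaleC: "X (c *\<^sub>C x) = c *\<^sub>C X x" for c x
  proof -
    have "(c *\<^sub>C x, c *\<^sub>C p x) \<in> proj_rel W S"
      using p [of x] sub
      by (simp add: proj_rel_iff complex_vector.subspace_scale W_scaleC cinner_scaleC_left
          flip: complex_vector.scale_right_diff_distrib)
    from X_eq [OF this] show ?thesis
      by (simp add: X_def W_scaleC flip: complex_vector.scale_right_diff_distrib)
  qed
  have X_le_W: "Re (cinner (X x) x) \<le> Re (cinner (W x) x)" for x
  proof -
    have "0 \<in> S"
      using sub by (rule complex_vector.subspace_0)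
    from quadratic_pythagoras [OF p this, of x] show ?thesis
      using psd by (simp add: X_inner psd_iff W.neg cinner_minus_left cinner_minus_right)
  qed
  have X_pos: "0 \<le> Re (cinner (X x) x)" for x
    using psd by (simp add: X_inner psd_iff)
  obtain K where K: "0 < K" "\<And>x. norm (W x) \<le> K * norm x"
    using psd bounded_clinear_pos_bound by (metis psd_iff selfadjoint_def)
  \<comment> \<open>Boundedness comes from \<open>X\<close> lying below \<open>W\<close>: the
    squared norm is at most \<open>K\<close> times the form of \<open>X\<close>, hence at most
    \<open>K\<close> times that of \<open>W\<close>.\<close>
  have X_bound: "norm (X x) \<le> norm x * K" for x
  proof -
    have "(norm (X x))\<^sup>2 \<le> K * Re (cinner (X x) x)"
      using psd_norm_power2_le [OF psd K(2), of "x - p x"] by (simp add: X_inner) (simp add: X_def)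
    also have "\<dots> \<le> K * Re (cinner (W x) x)"
      using X_le_W K(1) by (simp add: mult_left_mono)
    also have "\<dots> \<le> K * ((K * norm x) * norm x)"
    proof (rule mult_left_mono)
      have "Re (cinner (W x) x) \<le> norm (W x) * norm x"
        using Re_cinner_le_norm abs_le_D1 by blast
      also have "\<dots> \<le> (K * norm x) * norm x"
        using K(2) by (rule mult_right_mono) simp
      finally show "Re (cinner (W x) x) \<le> (K * norm x) * norm x" .
    qed (use K(1) in simp)
    finally have "(norm (X x))\<^sup>2 \<le> (norm x * K)\<^sup>2"
      by (simp add: power2_eq_square algebra_simps)
    then show ?thesis
      by (rule power2_le_imp_le) (use K(1) in simp)
  qed
  have "bounded_clinear X"
    unfolding bounded_clinear_iff
  proof (intro conjI allI)
    show "bounded_linear X"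
      by (rule bounded_linear_intro [where K = K]) (simp_all add: X_add scaleR_scaleC X_scaleC X_bound)
  qed (rule X_scaleC)
  then have X_sa: "selfadjoint X"
  proof (rule selfadjointI)
    show "Re (cinner (X x) y) = Re (cinner x (X y))" for x y
      by (simp add: Re_cinner_commute [of x "X y"] X_inner)
        (simp add: W_adjoint Re_cinner_commute [of "y - p y"])
  qed
  have X_psd: "psd X"
    using X_sa X_pos by (simp add: psd_iff)
  have W_sa: "selfadjoint W"
    using psd by (simp add: psd_iff)
  have X_mem: "X \<in> schur_set (orth_compl S) W"
    using X_psd X_sa W_sa X_le_W X_orth
    by (auto simp: schur_set_def psd_def op_le_def [of X] orth_compl_def)
  have X_max: "op_le Y X" if "Y \<in> schur_set (orth_compl S) W" for Y
  proof -
    have Y: "selfadjoint Y" "\<And>x. Re (cinner (Y x) x) \<le> Re (cinner (W x) x)"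
      "\<And>x s. s \<in> S \<Longrightarrow> cinner (Y x) s = 0"
      using that by (simp_all add: schur_set_def op_le_def orth_compl_def image_subset_iff)
    interpret Y: bounded_linear Y
      using Y(1) by (simp add: selfadjoint_def bounded_clinear_iff)
    \<comment> \<open>Since \<open>Y\<close> is selfadjoint and \<open>Y (Y s)\<close> is orthogonal
      to \<open>s\<close>, the vector \<open>Y s\<close> has norm zero.\<close>
    have Y0: "Y s = 0" if "s \<in> S" for s
    proof -
      have "cinner (Y s) (Y s) = 0"
        using Y(1) Y(3) [OF that, of "Y s"] by (metis cinner_commute complex_cnj_zero selfadjoint_def)
      then show ?thesis by (simp add: cinner_eq_zero_iff)
    qed
    have "Re (cinner (Y x) x) \<le> Re (cinner (X x) x)" for x
    proof -
      have "cinner (Y x) x = cinner (Y (x - p x)) (x - p x)"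
        using Y0 [OF pS] Y(3) [OF pS] by (simp add: Y.diff cinner_diff_right)
      then show ?thesis
        using Y(2) [of "x - p x"] by (simp add: X_inner)
    qed
    then show ?thesis
      using Y(1) X_sa by (simp add: op_le_def)
  qed
  have "schur (orth_compl S) W = X"
    unfolding schur_def
    by (rule the_equality) (use X_mem X_max op_le_antisym in blast)+
  then show "psd (schur (orth_compl S) W)" "schur (orth_compl S) W b = W (b - s)"
    using X_psd X_eq [OF assms(2)] by simp_all
qed

text \<open>The form of the Schur complement at \<open>b\<close> pairs \<open>W (b - s)\<close> with
  \<open>b\<close>, and subtracting \<open>s\<close> from \<open>b\<close> changes nothing by
  orthogonality to \<open>S\<close>.\<close>

lemma norm_sqrt_op_schur:
  assumes "complementable W S" "(b, s) \<in> proj_rel W S"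
  shows "norm (sqrt_op (schur (orth_compl S) W) b) = norm_op W (b - s)"
proof -
  have "cinner (W (b - s)) b = cinner (W (b - s)) (b - s)"
    using assms(2) by (simp add: proj_rel_iff cinner_diff_right)
  then have "(norm (sqrt_op (schur (orth_compl S) W) b))\<^sup>2 = (norm_op W (b - s))\<^sup>2"
    using schur_complementable [OF assms] by (simp add: norm_op_def norm_sqrt_op_power2 psd)
  then show ?thesis
    by (simp add: norm_op_def power2_eq_iff_nonneg)
qed

end

theorem proposition5p2:
  fixes W :: "'a::chilbert_space \<Rightarrow> 'a" and S :: "'a set" and b :: 'a
  assumes "separable_space (euclidean :: 'a topology)"
    and "psd W"
    and "complex_vector.subspace S"
    and "b \<in> Domain (proj_rel W S)"
  shows "is_minimum
           (norm (rel_value (id_minus (proj_rel W S) O graph_of (sqrt_op W)) b))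
           ((\<lambda>y. norm_op W (y - b)) ` S)
       \<and> (\<forall>y\<in>S. is_arg_min (\<lambda>y. norm_op W (y - b)) (\<lambda>y. y \<in> S) y
              \<longleftrightarrow> y \<in> proj_rel W S `` {b})
       \<and> (complementable W S \<longrightarrow>
            is_minimum (norm (sqrt_op (schur (orth_compl S) W) b))
              ((\<lambda>y. norm_op W (y - b)) ` S))"
proof -
  \<comment> \<open>One representative \<open>s\<close> serves all three claims: both closed
    formulas equal \<open>norm_op W (b - s)\<close>.\<close>
  obtain s where s: "(b, s) \<in> proj_rel W S"
    using assms(4) by blast
  note minimum = is_minimum_proj [OF assms(2,3) s]
  show ?thesis
    using minimum is_arg_min_iff_proj [OF assms(2,3) s] norm_sqrt_op_schur [OF assms(2,3) _ s]
    by (simp add: norm_rel_value_id_minus_proj [OF assms(2,3) s])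
qed

end
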